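(* Let $L\colon\mathbb{R}^d\to\mathbb{R}$ be an affine functional, $l\subseteq\mathbb{R}^d$ an affine subspace, $x\in\widetilde{E}(L,l)$, and $y\in\partial_{l}E(x,L,l)$, where $\partial_l$ denotes the boundary in the topology of $l$. Then one of the following two alternatives holds: (1) $y\in\partial E_{>0}$. (2) $y\in E(x,L,l)$ and there exists an affine subspace $l'\subsetneq l$ of $\mathbb{R}^d$ such that $y\in\widetilde{E}(L,l')$.
   Context: Segments: $[a,b]=\{(1-t)a+tb: 0\le t\le 1\}$, $(a,b)=\{(1-t)a+tb: 0<t<1\}$. $\overline{\mathbb{R}}=\mathbb{R}\cup\{-\infty,+\infty\}$. An $\overline{\mathbb{R}}$-valued function $B$ on a convex set is concave if its subgraph $\{(z,t): t\in\mathbb{R},\ t\le B(z)\}$ is convex. A function $B\colon\Omega\to\overline{\mathbb{R}}$ on $\Omega\subseteq\mathbb{R}^d$ is locally concave if its restriction to every segment contained in $\Omega$ is concave. Given $\Omega\subseteq\mathbb{R}^d$ and $f\colon\Omega\to\overline{\mathbb{R}}$, the minimal locally concave function is $\mathcal{B}(x)=\inf\{B(x): B\colon\Omega\to\overline{\mathbb{R}}\text{ locally concave},\ B\ge f\text{ on }\Omega\}$. Standing assumption: $\mathcal{B}$ is finite at every point of $\operatorname{int}\Omega$. Let $\overline{f}(y)=\limsup_{z\in\Omega,\,z\to y}f(z)$ for $y\in\operatorname{clos}\Omega$ be the upper semicontinuous majorant of $f$ ($z=y$ is allowed if $y\in\Omega$), $E_0=\{x\in\operatorname{int}\Omega:\mathcal{B}(x)=\overline{f}(x)\}$,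 and $E_{>0}=\operatorname{int}\Omega\setminus E_0$ (an open set). $\partial E_{>0}$ is the boundary in $\mathbb{R}^d$. For a closed convex set $W\subseteq E_{>0}$ with nonempty interior and an affine functional $L$ with $\mathcal{B}|_W\le L|_W$ put $U(W,L)=\{x\in W:\mathcal{B}(x)=L(x)\}$ (a closed convex set). A convex subset $F$ of a convex set $U$ is a face of $U$ if for all $y,z\in U$ with $(y,z)\cap F\neq\varnothing$ one has $[y,z]\subseteq F$. The pre-extremal set $\widetilde{E}(L,l)$, for an affine functional $L$ and an affine subspace $l$ of $\mathbb{R}^d$, is the set of points $x\in E_{>0}\cap l$ for which there is a closed convex $W\subseteq E_{>0}$ with nonempty interior such that $x\in\operatorname{int}W$, $\mathcal{B}|_W\le L|_W$, $x\in U(W,L)$, and $l\cap U(W,L)$ is a face of $U(W,L)$ with $\operatorname{aff}(l\cap U(W,L))=l$. For $x\in\widetilde{E}(L,l)$ the extremal set $E(x,L,l)$ is the connected component of $x$ in $\widetilde{E}(L,l)$. *)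

theory Defs
  imports "HOL-Analysis.Analysis"
begin

text \<open>
  Extended-real-valued functions on a set are total functions whose values outside that set
  are never used: concavity and majorization only constrain values on the set, and every set
  defined from the minimal locally concave function lies in the interior of the domain.
\<close>

definition ereal_concave_on :: "'a::real_vector set \<Rightarrow> ('a \<Rightarrow> ereal) \<Rightarrow> bool" where
  "ereal_concave_on S B \<longleftrightarrow> convex {(z, t::real). z \<in> S \<and> ereal t \<le> B z}"

definition locally_concave_on :: "'a::real_vector set \<Rightarrow> ('a \<Rightarrow> ereal) \<Rightarrow> bool" where
  "locally_concave_on \<Omega> B \<longleftrightarrow>
     (\<forall>a b. closed_segment a b \<subseteq> \<Omega> \<longrightarrow> ereal_concave_on (closed_segment a b) B)"

definition min_loc_concave ::
  "'a::real_vector set \<Rightarrow> ('a \<Rightarrow> ereal) \<Rightarrow> 'a \<Rightarrow> ereal" where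
  "min_loc_concave \<Omega> f x =
     Inf {B x | B. locally_concave_on \<Omega> B \<and> (\<forall>z\<in>\<Omega>. f z \<le> B z)}"

text \<open>
  The filter is \<open>inf (nhds y) (principal \<Omega>)\<close> and not \<open>at y within \<Omega>\<close>, since the upper limit
  defining the semicontinuous majorant is not punctured.
\<close>

definition usc_majorant ::
  "'a::topological_space set \<Rightarrow> ('a \<Rightarrow> ereal) \<Rightarrow> 'a \<Rightarrow> ereal" where
  "usc_majorant \<Omega> f y = Limsup (inf (nhds y) (principal \<Omega>)) f"

definition E_zero :: "'a::euclidean_space set \<Rightarrow> ('a \<Rightarrow> ereal) \<Rightarrow> 'a set" where
  "E_zero \<Omega> f = {x \<in> interior \<Omega>. min_loc_concave \<Omega> f x = usc_majorant \<Omega> f x}"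

definition E_pos :: "'a::euclidean_space set \<Rightarrow> ('a \<Rightarrow> ereal) \<Rightarrow> 'a set" where
  "E_pos \<Omega> f = interior \<Omega> - E_zero \<Omega> f"

definition affine_functional :: "('a::real_vector \<Rightarrow> real) \<Rightarrow> bool" where
  "affine_functional L \<longleftrightarrow> (\<exists>g c. linear g \<and> L = (\<lambda>x. g x + c))"

definition contact_set ::
  "'a::euclidean_space set \<Rightarrow> ('a \<Rightarrow> ereal) \<Rightarrow> 'a set \<Rightarrow> ('a \<Rightarrow> real) \<Rightarrow> 'a set" where
  "contact_set \<Omega> f W L = {x \<in> W. min_loc_concave \<Omega> f x = ereal (L x)}"

text \<open>
  Faces are those of the library, \<open>face_of\<close>.  Its open segments are empty when the endpoints
  coincide, which does not affect the notion; together with convexity of the face, containing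
  both endpoints is the same as containing the closed segment.
\<close>

definition pre_extremal ::
  "'a::euclidean_space set \<Rightarrow> ('a \<Rightarrow> ereal) \<Rightarrow> ('a \<Rightarrow> real) \<Rightarrow> 'a set \<Rightarrow> 'a set" where
  "pre_extremal \<Omega> f L l =
     {x \<in> E_pos \<Omega> f \<inter> l.
        \<exists>W. closed W \<and> convex W \<and> W \<subseteq> E_pos \<Omega> f \<and> interior W \<noteq> {} \<and> x \<in> interior W \<and>
            (\<forall>z\<in>W. min_loc_concave \<Omega> f z \<le> ereal (L z)) \<and>
            x \<in> contact_set \<Omega> f W L \<and>
            (l \<inter> contact_set \<Omega> f W L) face_of (contact_set \<Omega> f W L) \<and>
            affine hull (l \<inter> contact_set \<Omega> f W L) = l}"

definition extremal_set ::
  "'a::euclidean_space set \<Rightarrow> ('a \<Rightarrow> ereal) \<Rightarrow> 'a \<Rightarrow> ('a \<Rightarrow> real) \<Rightarrow> 'a set \<Rightarrow> 'a set" where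
  "extremal_set \<Omega> f x L l = connected_component_set (pre_extremal \<Omega> f L l) x"

end

theory Submission
  imports Defs
begin

text \<open>
  The minimal locally concave function \<open>\<B>\<close> is concave, hence continuous, on every open ball in
  the interior of the domain.  The theorem rests on the observation that membership in a
  pre-extremal set is a local property: whatever convex \<open>W\<close> witnesses \<open>x \<in> pre_extremal \<Omega> f L l\<close>,
  every other closed convex subset of \<open>E_pos \<Omega> f\<close> having \<open>x\<close> in its interior is a witness as well.
  Indeed both the inequality \<open>\<B> \<le> L\<close> and the face condition pass from one convex set to
  another by contracting points towards \<open>x\<close> until they enter the common part of the two sets
  (\<open>concave_le_affine_globalize\<close>, \<open>affine_section_face_local\<close>).

  If \<open>y\<close> is a boundary point of the extremal set outside \<open>frontier (E_pos \<Omega> f)\<close>, a small closed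
  ball \<open>W\<close> around \<open>y\<close> lies in \<open>E_pos \<Omega> f\<close> and has a point \<open>x'\<close> of the extremal set in its
  interior.  By locality \<open>W\<close> is a witness for \<open>x'\<close>; by continuity \<open>\<B> y = L y\<close>.  So \<open>W\<close> is a witness
  for \<open>y\<close>, and in fact for every point of the convex set \<open>F = l \<inter> contact_set \<Omega> f W L\<close> inside
  the open ball, which places \<open>y\<close> in the component of \<open>x'\<close>.  Were \<open>y\<close> in the
  relative interior of \<open>F\<close>, a neighbourhood of \<open>y\<close> in \<open>l\<close> would belong to the extremal set.
  Hence a supporting hyperplane cuts out a proper face of \<open>F\<close> through \<open>y\<close>, and \<open>l'\<close> is its
  affine hull.
\<close>

section \<open>Contraction towards a point\<close>

lemma eventually_contraction_in_open:
  fixes x q :: "'a::real_normed_vector"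
  assumes "open N" "x \<in> N"
  shows "eventually (\<lambda>t. (1 - t) *\<^sub>R x + t *\<^sub>R q \<in> N) (at_right 0)"
proof -
  have "((\<lambda>t. (1 - t) *\<^sub>R x + t *\<^sub>R q) \<longlongrightarrow> (1 - 0) *\<^sub>R x + 0 *\<^sub>R q) (at_right 0)"
    by (intro tendsto_intros)
  then show ?thesis
    using assms by (auto dest: topological_tendstoD)
qed

lemma contraction_in_open:
  fixes x :: "'a::real_normed_vector"
  assumes "open N" "x \<in> N" "finite Q"
  obtains t where "0 < t" "t < 1" "\<And>q. q \<in> Q \<Longrightarrow> (1 - t) *\<^sub>R x + t *\<^sub>R q \<in> N"
proof -
  have "eventually (\<lambda>t. \<forall>q\<in>Q. (1 - t) *\<^sub>R x + t *\<^sub>R q \<in> N) (at_right 0)"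
    using assms by (intro eventually_ball_finite ballI eventually_contraction_in_open)
  moreover have "eventually (\<lambda>t::real. t \<in> {0<..<1}) (at_right 0)"
    by (rule eventually_at_right_real) simp
  ultimately have "eventually (\<lambda>t. (\<forall>q\<in>Q. (1 - t) *\<^sub>R x + t *\<^sub>R q \<in> N) \<and> t \<in> {0<..<1}) (at_right 0)"
    by eventually_elim simp
  then obtain t where "(\<forall>q\<in>Q. (1 - t) *\<^sub>R x + t *\<^sub>R q \<in> N) \<and> t \<in> {0<..<1}"
    using eventually_happens trivial_limit_at_right_real by blast
  then show thesis
    using that[of t] by auto
qed

lemma affine_contraction_cancel:
  fixes x q :: "'a::real_vector"
  assumes "affine A" "x \<in> A" "(1 - t) *\<^sub>R x + t *\<^sub>R q \<in> A" "t \<noteq> 0"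
  shows "q \<in> A"
proof -
  have "(1 - 1/t) *\<^sub>R x + (1/t) *\<^sub>R ((1 - t) *\<^sub>R x + t *\<^sub>R q) \<in> A"
    using mem_affine[OF assms(1-3), of "1 - 1/t" "1/t"] by simp
  also have "(1 - 1/t) *\<^sub>R x + (1/t) *\<^sub>R ((1 - t) *\<^sub>R x + t *\<^sub>R q)
      = ((1 - 1/t) + (1/t) * (1 - t)) *\<^sub>R x + ((1/t) * t) *\<^sub>R q"
    by (simp only: scaleR_add_left scaleR_add_right scaleR_scaleR add.assoc)
  also have "(1 - 1/t) + (1/t) * (1 - t) = 0"
    using assms(4) by (simp add: field_simps)
  finally show ?thesis
    using assms(4) by simp
qed

lemma contraction_open_segment:
  fixes x a b p :: "'a::real_vector"
  assumes "p \<in> open_segment a b" "t \<noteq> 0"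
  shows "(1 - t) *\<^sub>R x + t *\<^sub>R p
           \<in> open_segment ((1 - t) *\<^sub>R x + t *\<^sub>R a) ((1 - t) *\<^sub>R x + t *\<^sub>R b)"
proof -
  obtain u where u: "a \<noteq> b" "0 < u" "u < 1" "p = (1 - u) *\<^sub>R a + u *\<^sub>R b"
    using assms(1) by (auto simp: in_segment)
  have "(1 - t) *\<^sub>R x + t *\<^sub>R p
      = (1 - u) *\<^sub>R ((1 - t) *\<^sub>R x + t *\<^sub>R a) + u *\<^sub>R ((1 - t) *\<^sub>R x + t *\<^sub>R b)"
    unfolding u(4) by (simp add: algebra_simps)
  then show ?thesis
    using u(1-3) assms(2) by (auto simp: in_segment)
qed

text \<open>
  A contraction towards \<open>x\<close> carries any finite configuration of points of one convex set into
  the part near \<open>x\<close> that it shares with the other; since \<open>x \<in> l\<close>, it neither creates nor destroys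
  membership in \<open>l\<close>.
\<close>

lemma affine_section_face_local:
  fixes S T :: "'a::real_normed_vector set"
  assumes S: "convex S" and T: "convex T" and l: "affine l"
    and x: "x \<in> l" "x \<in> S"
    and N: "open N" "x \<in> N" "S \<inter> N = T \<inter> N"
    and face: "(l \<inter> S) face_of S" and hull: "affine hull (l \<inter> S) = l"
  shows "(l \<inter> T) face_of T" "affine hull (l \<inter> T) = l"
proof -
  have xT: "x \<in> T"
    using x N by blast
  have lt: "(1 - t) *\<^sub>R x + t *\<^sub>R q \<in> l" if "q \<in> l" for t q
    using l x that by (simp add: mem_affine)
  have conv: "(1 - t) *\<^sub>R x + t *\<^sub>R q \<in> C"
    if "convex C" "x \<in> C" "q \<in> C" "0 < t" "t < 1" for C t q
    using that by (simp add: convexD)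
  show "(l \<inter> T) face_of T"
    unfolding face_of_def
  proof (intro conjI ballI impI)
    show "convex (l \<inter> T)"
      using T l by (simp add: affine_imp_convex convex_Int)
    fix a b p
    assume a: "a \<in> T" and b: "b \<in> T" and p: "p \<in> l \<inter> T" and seg: "p \<in> open_segment a b"
    obtain t where t: "0 < t" "t < 1"
      and tN: "\<And>q. q \<in> {a, b, p} \<Longrightarrow> (1 - t) *\<^sub>R x + t *\<^sub>R q \<in> N"
      using contraction_in_open[OF N(1,2), of "{a, b, p}"] by blast
    have inS: "(1 - t) *\<^sub>R x + t *\<^sub>R q \<in> S" if "q \<in> {a, b, p}" for q
      using conv[OF T xT _ t, of q] tN[OF that] N(3) that a b p by blast
    have "(1 - t) *\<^sub>R x + t *\<^sub>R p
        \<in> open_segment ((1 - t) *\<^sub>R x + t *\<^sub>R a) ((1 - t) *\<^sub>R x + t *\<^sub>R b)"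
      using contraction_open_segment[OF seg] t by simp
    then have "(1 - t) *\<^sub>R x + t *\<^sub>R a \<in> l \<inter> S \<and> (1 - t) *\<^sub>R x + t *\<^sub>R b \<in> l \<inter> S"
      using face_ofD[OF face] inS lt p by blast
    then show "a \<in> l \<inter> T" "b \<in> l \<inter> T"
      using affine_contraction_cancel[OF l x(1)] t a b by auto
  qed auto
  have "l \<inter> S \<subseteq> affine hull (l \<inter> T)"
  proof
    fix q assume q: "q \<in> l \<inter> S"
    obtain t where t: "0 < t" "t < 1" and tN: "(1 - t) *\<^sub>R x + t *\<^sub>R q \<in> N"
      using contraction_in_open[OF N(1,2), of "{q}"] by blast
    have "(1 - t) *\<^sub>R x + t *\<^sub>R q \<in> l \<inter> T"
      using conv[OF S x(2) _ t, of q] lt tN q N(3) by blast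
    then show "q \<in> affine hull (l \<inter> T)"
      using affine_contraction_cancel[OF affine_affine_hull, of x "l \<inter> T" t q] xT x t
      by (simp add: hull_inc)
  qed
  then have "l \<subseteq> affine hull (l \<inter> T)"
    using hull by (metis hull_minimal affine_affine_hull)
  moreover have "affine hull (l \<inter> T) \<subseteq> l"
    using l by (simp add: hull_minimal)
  ultimately show "affine hull (l \<inter> T) = l"
    by blast
qed

section \<open>Concave functions below an affine functional\<close>

lemma affine_functional_combination:
  assumes "affine_functional L" "u + v = 1"
  shows "L (u *\<^sub>R a + v *\<^sub>R b) = u * L a + v * L b"
proof -
  obtain g c where g: "linear g" and L: "L = (\<lambda>x. g x + c)"
    using assms(1) by (auto simp: affine_functional_def)
  have "c = u * c + v * c"
    using assms(2) by (metis distrib_right mult_1)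
  then show ?thesis
    using g by (simp add: L linear_add linear_scale algebra_simps)
qed

lemma affine_functional_continuous:
  fixes L :: "'a::euclidean_space \<Rightarrow> real"
  assumes "affine_functional L"
  shows "continuous_on S L"
proof -
  obtain g c where "linear g" "L = (\<lambda>x. g x + c)"
    using assms by (auto simp: affine_functional_def)
  then show ?thesis
    by (auto intro: continuous_on_add linear_continuous_on_compose[OF continuous_on_id])
qed

text \<open>A concave function that touches an affine functional from below near one point has that
  functional as a global supergradient there.\<close>

lemma concave_le_affine_globalize:
  fixes h :: "'a::real_normed_vector \<Rightarrow> real"
  assumes h: "concave_on W h" and L: "affine_functional L"
    and x: "x \<in> W" "h x = L x"
    and N: "open N" "x \<in> N" "\<And>z. z \<in> N \<Longrightarrow> h z \<le> L z"
    and z: "z \<in> W"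
  shows "h z \<le> L z"
proof -
  obtain t where t: "0 < t" "t < 1" and tN: "(1 - t) *\<^sub>R x + t *\<^sub>R z \<in> N"
    using contraction_in_open[OF N(1,2), of "{z}"] by blast
  have "(1 - t) * h x + t * h z \<le> h ((1 - t) *\<^sub>R x + t *\<^sub>R z)"
    using h[unfolded concave_on_iff] t x(1) z by simp
  also have "\<dots> \<le> L ((1 - t) *\<^sub>R x + t *\<^sub>R z)"
    by (rule N(3)[OF tN])
  also have "\<dots> = (1 - t) * L x + t * L z"
    by (rule affine_functional_combination[OF L]) simp
  finally show ?thesis
    using x t by simp
qed

lemma convex_contact_concave:
  assumes h: "concave_on W h" and L: "affine_functional L"
    and le: "\<And>z. z \<in> W \<Longrightarrow> h z \<le> L z"
  shows "convex {z \<in> W. h z = L z}"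
proof (rule convexI)
  fix a b and u v :: real
  assume a: "a \<in> {z \<in> W. h z = L z}" and b: "b \<in> {z \<in> W. h z = L z}"
    and uv: "0 \<le> u" "0 \<le> v" "u + v = 1"
  have inW: "u *\<^sub>R a + v *\<^sub>R b \<in> W"
    using h a b uv by (simp add: concave_on_iff convexD)
  have "u * h a + v * h b \<le> h (u *\<^sub>R a + v *\<^sub>R b)"
    using h[unfolded concave_on_iff] a b uv by blast
  moreover have "L (u *\<^sub>R a + v *\<^sub>R b) = u * L a + v * L b"
    by (rule affine_functional_combination[OF L uv(3)])
  ultimately have "L (u *\<^sub>R a + v *\<^sub>R b) \<le> h (u *\<^sub>R a + v *\<^sub>R b)"
    using a b by simp
  with le[OF inW] inW show "u *\<^sub>R a + v *\<^sub>R b \<in> {z \<in> W. h z = L z}"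
    by simp
qed

section \<open>Concavity of the minimal locally concave function\<close>

text \<open>The subgraph of an infimum is the intersection of the subgraphs.\<close>

lemma locally_concave_min_loc_concave: "locally_concave_on \<Omega> (min_loc_concave \<Omega> f)"
  unfolding locally_concave_on_def ereal_concave_on_def
proof (intro allI impI)
  fix a b assume ab: "closed_segment a b \<subseteq> \<Omega>"
  let ?\<F> = "{B. locally_concave_on \<Omega> B \<and> (\<forall>z\<in>\<Omega>. f z \<le> B z)}"
  let ?sub = "\<lambda>B. {(z, t::real). z \<in> closed_segment a b \<and> ereal t \<le> B z}"
  have "?sub (min_loc_concave \<Omega> f) = (closed_segment a b \<times> UNIV) \<inter> (\<Inter>B\<in>?\<F>. ?sub B)"
    by (auto simp: min_loc_concave_def le_Inf_iff)
  moreover have "convex (?sub B)" if "B \<in> ?\<F>" for B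
    using that ab by (simp add: locally_concave_on_def ereal_concave_on_def)
  ultimately show "convex (?sub (min_loc_concave \<Omega> f))"
    by (auto intro!: convex_Int convex_Times convex_INT)
qed

lemma concave_on_min_loc_concave:
  assumes fin: "\<forall>z\<in>interior \<Omega>. \<bar>min_loc_concave \<Omega> f z\<bar> \<noteq> \<infinity>"
    and W: "convex W" "W \<subseteq> interior \<Omega>"
  shows "concave_on W (\<lambda>z. real_of_ereal (min_loc_concave \<Omega> f z))" (is "concave_on W ?b")
  unfolding concave_on_iff
proof (intro conjI ballI allI impI)
  fix a b and u v :: real
  assume a: "a \<in> W" and b: "b \<in> W" and uv: "0 \<le> u" "0 \<le> v" "u + v = 1"
  let ?sub = "{(z, t::real). z \<in> closed_segment a b \<and> ereal t \<le> min_loc_concave \<Omega> f z}"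
  have real: "ereal (?b z) = min_loc_concave \<Omega> f z" if "z \<in> W" for z
    using fin[rule_format, of z] W(2) that by (intro ereal_real') auto
  have "closed_segment a b \<subseteq> \<Omega>"
    using W a b closed_segment_subset interior_subset by blast
  then have "convex ?sub"
    using locally_concave_min_loc_concave[of \<Omega> f]
    unfolding locally_concave_on_def ereal_concave_on_def by blast
  then have "u *\<^sub>R (a, ?b a) + v *\<^sub>R (b, ?b b) \<in> ?sub"
    using uv real a b by (intro convexD) auto
  then have "ereal (u * ?b a + v * ?b b) \<le> ereal (?b (u *\<^sub>R a + v *\<^sub>R b))"
    using real[of "u *\<^sub>R a + v *\<^sub>R b"] W a b uv by (simp add: convexD)
  then show "u * ?b a + v * ?b b \<le> ?b (u *\<^sub>R a + v *\<^sub>R b)"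
    by simp
qed (rule W)

section \<open>Locality of pre-extremal sets\<close>

lemma E_pos_subset_interior: "E_pos \<Omega> f \<subseteq> interior \<Omega>"
  by (auto simp: E_pos_def)

lemma contact_set_real:
  assumes "\<forall>z\<in>interior \<Omega>. \<bar>min_loc_concave \<Omega> f z\<bar> \<noteq> \<infinity>" "W \<subseteq> E_pos \<Omega> f"
  shows "contact_set \<Omega> f W L = {z \<in> W. real_of_ereal (min_loc_concave \<Omega> f z) = L z}"
proof -
  have "ereal (real_of_ereal (min_loc_concave \<Omega> f z)) = min_loc_concave \<Omega> f z" if "z \<in> W" for z
    using assms(1)[rule_format, of z] assms(2) E_pos_subset_interior[of \<Omega> f] that
    by (intro ereal_real') auto
  then show ?thesis
    unfolding contact_set_def by (metis (lifting) ereal.inject)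
qed

text \<open>The original witness and \<open>W\<close> have the same contact points in the intersection of their
  interiors, so the contraction arguments transfer every property of the former to \<open>W\<close>.\<close>

lemma pre_extremal_any_witness:
  assumes fin: "\<forall>z\<in>interior \<Omega>. \<bar>min_loc_concave \<Omega> f z\<bar> \<noteq> \<infinity>"
    and L: "affine_functional L" and l: "affine l"
    and x: "x \<in> pre_extremal \<Omega> f L l"
    and W: "convex W" "W \<subseteq> E_pos \<Omega> f" "x \<in> interior W"
  shows "\<And>z. z \<in> W \<Longrightarrow> min_loc_concave \<Omega> f z \<le> ereal (L z)"
    and "convex (contact_set \<Omega> f W L)"
    and "(l \<inter> contact_set \<Omega> f W L) face_of contact_set \<Omega> f W L"
    and "affine hull (l \<inter> contact_set \<Omega> f W L) = l"
proof -
  define b where "b = (\<lambda>z. real_of_ereal (min_loc_concave \<Omega> f z))"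
  have real: "min_loc_concave \<Omega> f z = ereal (b z)" if "z \<in> E_pos \<Omega> f" for z
    unfolding b_def using fin[rule_format, of z] E_pos_subset_interior[of \<Omega> f] that
    by (intro ereal_real'[symmetric]) auto
  have concave: "concave_on V b" if "convex V" "V \<subseteq> E_pos \<Omega> f" for V
    unfolding b_def using that E_pos_subset_interior[of \<Omega> f]
    by (intro concave_on_min_loc_concave[OF fin]) auto
  have contact: "contact_set \<Omega> f V L = {z \<in> V. b z = L z}" if "V \<subseteq> E_pos \<Omega> f" for V
    unfolding b_def by (rule contact_set_real[OF fin that])
  obtain V where V: "convex V" "V \<subseteq> E_pos \<Omega> f" "x \<in> interior V"
    and leV: "\<And>z. z \<in> V \<Longrightarrow> min_loc_concave \<Omega> f z \<le> ereal (L z)"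
    and xV: "x \<in> contact_set \<Omega> f V L"
    and faceV: "(l \<inter> contact_set \<Omega> f V L) face_of contact_set \<Omega> f V L"
    and hullV: "affine hull (l \<inter> contact_set \<Omega> f V L) = l"
    and xl: "x \<in> l"
    using x unfolding pre_extremal_def by blast
  have leV': "b z \<le> L z" if "z \<in> V" for z
    using leV[OF that] real[of z] V(2) that by auto
  have leW: "b z \<le> L z" if "z \<in> W" for z
  proof (rule concave_le_affine_globalize[OF concave[OF W(1,2)] L _ _ _ V(3) _ that])
    show "x \<in> W" using W(3) interior_subset by blast
    show "b x = L x" using xV contact[OF V(2)] by simp
  qed (use leV' interior_subset in auto)
  show "min_loc_concave \<Omega> f z \<le> ereal (L z)" if "z \<in> W" for z
    using leW[OF that] real[of z] W(2) that by auto
  show convW: "convex (contact_set \<Omega> f W L)"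
    unfolding contact[OF W(2)] by (rule convex_contact_concave[OF concave[OF W(1,2)] L leW])
  have convV: "convex (contact_set \<Omega> f V L)"
    unfolding contact[OF V(2)] by (rule convex_contact_concave[OF concave[OF V(1,2)] L leV'])
  have agree: "contact_set \<Omega> f V L \<inter> (interior V \<inter> interior W)
      = contact_set \<Omega> f W L \<inter> (interior V \<inter> interior W)"
    using interior_subset[of V] interior_subset[of W] by (auto simp: contact_set_def)
  show "(l \<inter> contact_set \<Omega> f W L) face_of contact_set \<Omega> f W L"
    and "affine hull (l \<inter> contact_set \<Omega> f W L) = l"
    using affine_section_face_local[OF convV convW l xl xV _ _ agree faceV hullV] V(3) W(3)
    by auto
qed

lemma pre_extremal_if_shared_witness:
  assumes fin: "\<forall>z\<in>interior \<Omega>. \<bar>min_loc_concave \<Omega> f z\<bar> \<noteq> \<infinity>"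
    and L: "affine_functional L" and l: "affine l"
    and x: "x \<in> pre_extremal \<Omega> f L l"
    and W: "closed W" "convex W" "W \<subseteq> E_pos \<Omega> f" "x \<in> interior W"
    and z: "z \<in> interior W" "z \<in> l \<inter> contact_set \<Omega> f W L"
  shows "z \<in> pre_extremal \<Omega> f L l"
proof -
  note witness = pre_extremal_any_witness[OF fin L l x W(2-4)]
  have "z \<in> E_pos \<Omega> f \<inter> l"
    using W(3) z interior_subset[of W] by blast
  moreover have "interior W \<noteq> {}" "z \<in> contact_set \<Omega> f W L"
    using z by auto
  ultimately show ?thesis
    unfolding pre_extremal_def using W(1-3) z(1) witness(1,3,4) by blast
qed

text \<open>A finite concave function is continuous on open sets, so contact survives limits inside
  the domain.\<close>

lemma min_loc_concave_eq_affine_closure: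
  fixes \<Omega> :: "'a::euclidean_space set"
  assumes fin: "\<forall>z\<in>interior \<Omega>. \<bar>min_loc_concave \<Omega> f z\<bar> \<noteq> \<infinity>"
    and L: "affine_functional L"
    and y: "y \<in> interior \<Omega>" "y \<in> closure {z \<in> interior \<Omega>. min_loc_concave \<Omega> f z = ereal (L z)}"
  shows "min_loc_concave \<Omega> f y = ereal (L y)"
proof -
  define b where "b = (\<lambda>z. real_of_ereal (min_loc_concave \<Omega> f z))"
  obtain r where r: "r > 0" "ball y r \<subseteq> interior \<Omega>"
    using y(1) open_interior open_contains_ball by blast
  have "concave_on (ball y r) b"
    unfolding b_def using r by (intro concave_on_min_loc_concave[OF fin]) auto
  then have "continuous_on (ball y r) (\<lambda>z. - (- b z))"
    by (intro continuous_intros convex_on_continuous) (auto simp: concave_on_def)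
  then have "continuous_on (ball y r) (\<lambda>z. b z - L z)"
    using affine_functional_continuous[OF L] by (intro continuous_on_diff) simp_all
  then have "isCont (\<lambda>z. b z - L z) y"
    using r by (simp add: continuous_on_eq_continuous_at)
  moreover obtain s where s: "\<And>n. s n \<in> {z \<in> interior \<Omega>. min_loc_concave \<Omega> f z = ereal (L z)}"
    and "s \<longlonglongrightarrow> y"
    using y(2) unfolding closure_sequential by blast
  ultimately have "(\<lambda>n. b (s n) - L (s n)) \<longlonglongrightarrow> b y - L y"
    using isCont_tendsto_compose by blast
  moreover have "b (s n) - L (s n) = 0" for n
    using s[of n] by (simp add: b_def)
  ultimately have "b y = L y"
    by (simp add: LIMSEQ_const_iff)
  then show ?thesis
    using ereal_real'[of "min_loc_concave \<Omega> f y"] fin y(1) by (simp add: b_def)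
qed

section \<open>Boundary points of extremal sets\<close>

theorem lemma11p11:
  fixes \<Omega> :: "'a::euclidean_space set"
    and f :: "'a \<Rightarrow> ereal"
    and L :: "'a \<Rightarrow> real"
    and l :: "'a set"
    and x y :: 'a
  assumes finite_B: "\<forall>z\<in>interior \<Omega>. \<bar>min_loc_concave \<Omega> f z\<bar> \<noteq> \<infinity>"
    and L: "affine_functional L"
    and l: "affine l"
    and x: "x \<in> pre_extremal \<Omega> f L l"
    and y: "y \<in> (top_of_set l) frontier_of (extremal_set \<Omega> f x L l)"
  shows "y \<in> frontier (E_pos \<Omega> f) \<or>
         (y \<in> extremal_set \<Omega> f x L l \<and>
          (\<exists>l'. affine l' \<and> l' \<subset> l \<and> y \<in> pre_extremal \<Omega> f L l'))"
proof (cases "y \<in> frontier (E_pos \<Omega> f)")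
  case False
  let ?E = "extremal_set \<Omega> f x L l"
  have E_sub: "?E \<subseteq> pre_extremal \<Omega> f L l"
    unfolding extremal_set_def by (rule connected_component_subset)
  have E_pos: "?E \<subseteq> E_pos \<Omega> f" and E_l: "?E \<subseteq> l"
    using E_sub by (auto simp: pre_extremal_def)
  have y_clos: "y \<in> (top_of_set l) closure_of ?E" and y_int: "y \<notin> (top_of_set l) interior_of ?E"
    using y by (auto simp: frontier_of_def)
  have yl: "y \<in> l"
    using y_clos closure_of_subset_topspace by fastforce
  have y_closure: "y \<in> closure ?E"
    using y_clos closure_of_subtopology_subset[of euclidean l ?E] by auto
  then have "y \<in> interior (E_pos \<Omega> f)"
    using False closure_mono[OF E_pos] by (auto simp: frontier_def)
  then obtain r where r: "r > 0" "cball y r \<subseteq> E_pos \<Omega> f"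
    using mem_interior_cball by blast
  define W where "W = cball y r"
  have W: "closed W" "convex W" "W \<subseteq> E_pos \<Omega> f" and intW: "interior W = ball y r"
    using r by (auto simp: W_def)
  obtain x' where x': "x' \<in> ?E" and x'W: "x' \<in> interior W"
    using y_closure r unfolding intW
    by (metis closure_approachable dist_commute mem_ball)
  have x'_pre: "x' \<in> pre_extremal \<Omega> f L l"
    using x' E_sub by blast
  note witness = pre_extremal_any_witness[OF finite_B L l x'_pre W(2,3) x'W]
  define U where "U = contact_set \<Omega> f W L"
  define F where "F = l \<inter> U"
  have face_F: "F face_of U" and hull_F: "affine hull F = l"
    using witness by (auto simp: F_def U_def)
  have conv_F: "convex F"
    using face_F face_of_imp_convex by blast

  have "?E \<subseteq> {z \<in> interior \<Omega>. min_loc_concave \<Omega> f z = ereal (L z)}"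
    using E_sub E_pos_subset_interior[of \<Omega> f] by (auto simp: pre_extremal_def contact_set_def)
  then have "y \<in> closure {z \<in> interior \<Omega>. min_loc_concave \<Omega> f z = ereal (L z)}"
    using y_closure closure_mono by blast
  moreover have "y \<in> interior \<Omega>"
    using r E_pos_subset_interior[of \<Omega> f] by (meson centre_in_cball less_imp_le subsetD)
  ultimately have "min_loc_concave \<Omega> f y = ereal (L y)"
    using min_loc_concave_eq_affine_closure[OF finite_B L] by blast
  then have yF: "y \<in> F"
    using yl r by (auto simp: F_def U_def contact_set_def W_def)

  \<comment> \<open>The ball witnesses all of its interior points in \<open>F\<close> at once, and these form a convex set
    containing \<open>x'\<close> and \<open>y\<close>.\<close>
  have core_pre: "F \<inter> interior W \<subseteq> pre_extremal \<Omega> f L l"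
    using pre_extremal_if_shared_witness[OF finite_B L l x'_pre W x'W] by (auto simp: F_def U_def)
  have "x' \<in> F"
    using x'_pre x'W interior_subset[of W]
    by (auto simp: F_def U_def pre_extremal_def contact_set_def)
  then have core_E: "F \<inter> interior W \<subseteq> ?E"
    using connected_component_maximal[OF _ _ core_pre, of x'] x'W conv_F W(2)
      connected_component_eq[OF x'[unfolded extremal_set_def]]
    by (simp add: extremal_set_def convex_connected convex_Int convex_interior)
  have yE: "y \<in> ?E"
    using core_E yF r intW by auto

  have "y \<notin> rel_interior F"
  proof
    assume "y \<in> rel_interior F"
    then have "openin (top_of_set l) (rel_interior F)"
      using openin_rel_interior[of F] by (simp add: hull_F)
    then have "openin (top_of_set l) (rel_interior F \<inter> ball y r)"
      by (simp add: openin_Int_open)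
    moreover have "rel_interior F \<inter> ball y r \<subseteq> ?E"
      using core_E intW rel_interior_subset by blast
    ultimately have "y \<in> (top_of_set l) interior_of ?E"
      using \<open>y \<in> rel_interior F\<close> r
      by (meson IntI centre_in_ball interior_of_maximal subsetD)
    with y_int show False ..
  qed
  then obtain a where a: "\<And>z. z \<in> F \<Longrightarrow> a \<bullet> y \<le> a \<bullet> z"
    and a_strict: "\<And>z. z \<in> rel_interior F \<Longrightarrow> a \<bullet> y < a \<bullet> z"
    using supporting_hyperplane_rel_boundary[OF conv_F yF] by metis
  \<comment> \<open>A face of \<open>F\<close> is a face of \<open>U\<close> by transitivity, and a face is the trace of its affine hull;
    so \<open>affine hull F'\<close> cuts \<open>U\<close> exactly in \<open>F'\<close>, as the definition of pre-extremal sets demands.\<close>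
  define F' where "F' = F \<inter> {z. a \<bullet> z = a \<bullet> y}"
  have "F' face_of F"
    unfolding F'_def using a by (intro face_of_Int_supporting_hyperplane_ge conv_F) auto
  then have face_F': "F' face_of U"
    using face_F face_of_trans by blast
  have yF': "y \<in> F'"
    using yF by (simp add: F'_def)
  define l' where "l' = affine hull F'"
  have F'_eq: "l' \<inter> U = F'"
    using face_of_imp_eq_affine_Int[OF _ face_F'] witness(2) by (simp add: l'_def U_def)
  have "l' \<noteq> l"
  proof
    assume "l' = l"
    then have "F' = F"
      using F'_eq by (simp add: F_def)
    moreover have "rel_interior F \<noteq> {}"
      using yF conv_F rel_interior_eq_empty by blast
    ultimately show False
      using a_strict rel_interior_subset[of F] by (force simp: F'_def)
  qed
  moreover have "l' \<subseteq> l"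
    unfolding l'_def F'_def using l by (intro hull_minimal) (auto simp: F_def)
  moreover have "y \<in> pre_extremal \<Omega> f L l'"
  proof -
    have "y \<in> l'" "y \<in> contact_set \<Omega> f W L"
      using yF' F'_eq by (auto simp: U_def)
    moreover have "(l' \<inter> contact_set \<Omega> f W L) face_of contact_set \<Omega> f W L"
      "affine hull (l' \<inter> contact_set \<Omega> f W L) = l'"
      using face_F' F'_eq by (auto simp: U_def l'_def)
    moreover have "y \<in> interior W" "y \<in> E_pos \<Omega> f"
      using r by (auto simp: intW)
    ultimately show ?thesis
      unfolding pre_extremal_def using W witness(1) by blast
  qed
  moreover have "affine l'"
    by (simp add: l'_def affine_affine_hull)
  ultimately show ?thesis
    using yE by blast
qed simp

end
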